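(* Let $b,\rho\in\mathbb{C}$ with $\operatorname{Re}(\rho)>0$ and let $z\in\mathbb{C}\setminus(-\infty,0]$. (i) For $\nu,c\in\mathbb{C}$ with $\operatorname{Re}(\nu)>-\tfrac32$, $\operatorname{Re}(c)>\tfrac12$, $c\neq\tfrac32$, $$\frac{\partial}{\partial\rho}\big[g_\nu^{(b,c)}(z;\rho)\big]=\frac{-1}{c-\frac32}\,g_\nu^{(b,c-1)}(z;\rho).$$ (ii) For $\nu,\lambda\in\mathbb{C}$ with $\operatorname{Re}(\nu)>-1$, $\operatorname{Re}(\lambda)>0$, $\lambda\neq1$, $$\frac{\partial}{\partial\rho}\big[C_\nu^{(b,\lambda)}(z;\rho)\big]=\frac{-1}{\lambda-1}\,C_\nu^{(b,\lambda-1)}(z;\rho).$$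
   Context: For $\rho\in\mathbb{C}$ with $\operatorname{Re}(\rho)>0$ and $x\in\mathbb{C}$ put $\Gamma_\rho(x)=\int_0^\infty t^{x-1}e^{-t-\rho/t}\,dt$. The generalized Pochhammer symbol is $(\lambda;\rho)_\nu:=\Gamma_\rho(\lambda+\nu)/\Gamma(\lambda)$ for $\lambda,\nu\in\mathbb{C}$, where $1/\Gamma$ is read as an entire function (zero at $0,-1,-2,\dots$). The unified four parameter Bessel function is $G_\nu^{(b,c)}(z;\rho):=\sum_{k=0}^\infty \frac{(-b)^k (c;\rho)_{2k+\nu}}{\Gamma(\nu+k+1)\,\Gamma(\nu+2k+1)}\,\frac{(z/2)^{2k+\nu}}{k!}$. The generalized four parameter spherical Bessel and Bessel-Clifford functions are $$g_\nu^{(b,c)}(z;\rho):=\sqrt{\tfrac{\pi}{2z}}\,G_{\nu+\frac12}^{(b,c-\frac12)}(z;\rho)=\frac{\sqrt\pi}{2}\sum_{k=0}^\infty\frac{(-b)^k(c-\frac12;\rho)_{2k+\nu+\frac12}}{k!\,\Gamma(\nu+k+\frac32)\,\Gamma(\nu+2k+\frac32)}\Big(\frac z2\Big)^{2k+\nu},$$ $$C_\nu^{(b,\lambda)}(z;\rho):=z^{-\nu/2}G_\nu^{(b,\lambda)}(2\sqrt z;\rho)=\sum_{k=0}^\infty\frac{(-b)^k(\lambda;\rho)_{2k+\nu}}{k!\,\Gamma(\nu+k+1)\,\Gamma(\nu+2k+1)}\,z^k.$$ Functions with shifted parameters are given by the same series. Powers and square roots are principal. *)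

theory Defs
  imports "HOL-Analysis.Analysis"
begin

definition Gamma_rho :: "complex \<Rightarrow> complex \<Rightarrow> complex" where
  "Gamma_rho \<rho> x =
     (LINT t:{0<..}|lborel. complex_of_real t powr (x - 1) * exp (- of_real t - \<rho> / of_real t))"

text \<open>
  Reciprocals of the Gamma function are rendered by the entire function \<^const>\<open>rGamma\<close>,
  which vanishes at the nonpositive integers.
\<close>

definition gen_pochhammer :: "complex \<Rightarrow> complex \<Rightarrow> complex \<Rightarrow> complex" where
  "gen_pochhammer l \<rho> \<nu> = Gamma_rho \<rho> (l + \<nu>) * rGamma l"

definition bessel_G :: "complex \<Rightarrow> complex \<Rightarrow> complex \<Rightarrow> complex \<Rightarrow> complex \<Rightarrow> complex" where
  "bessel_G \<nu> b c z \<rho> =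
     (\<Sum>k. (- b) ^ k * gen_pochhammer c \<rho> (2 * of_nat k + \<nu>)
           * rGamma (\<nu> + of_nat k + 1) * rGamma (\<nu> + 2 * of_nat k + 1)
           * ((z / 2) powr (2 * of_nat k + \<nu>) / fact k))"

definition spherical_bessel_g :: "complex \<Rightarrow> complex \<Rightarrow> complex \<Rightarrow> complex \<Rightarrow> complex \<Rightarrow> complex" where
  "spherical_bessel_g \<nu> b c z \<rho> =
     csqrt (of_real pi / (2 * z)) * bessel_G (\<nu> + 1/2) b (c - 1/2) z \<rho>"

definition bessel_clifford_C :: "complex \<Rightarrow> complex \<Rightarrow> complex \<Rightarrow> complex \<Rightarrow> complex \<Rightarrow> complex" where
  "bessel_clifford_C \<nu> b l z \<rho> = z powr (- \<nu> / 2) * bessel_G \<nu> b l (2 * csqrt z) \<rho>"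

end

theory Submission
  imports Defs "HOL-Complex_Analysis.Complex_Analysis"
begin

text \<open>
  Everything rests on the identity \<open>d/d\<rho> \<Gamma>\<^sub>\<rho>(x) = - \<Gamma>\<^sub>\<rho>(x - 1)\<close>, obtained by differentiating under the
  integral sign: each derivative in \<open>\<rho>\<close> of the kernel produces a factor \<open>- 1 / t\<close>, which lowers the
  exponent \<open>x - 1\<close> by one.  Since \<open>1 / \<Gamma>(l - 1) = (l - 1) / \<Gamma>(l)\<close>, the generalized Pochhammer symbol
  satisfies \<open>d/d\<rho> (l; \<rho>)\<^sub>\<nu> = - (l - 1; \<rho>)\<^sub>\<nu> / (l - 1)\<close>, and summing over the terms of the series
  gives the same rule for the function \<open>G\<close>.  The spherical Bessel and Bessel-Clifford functions
  are \<open>G\<close> multiplied by a factor that does not depend on \<open>\<rho>\<close>, so they inherit it.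

  Two analytic points have to be settled.  Differentiation under the integral sign is justified by
  dominated convergence.  The factor \<open>exp (- \<rho> / t)\<close> decays at \<open>0\<close> faster than any power of \<open>t\<close>, so
  all kernels are integrable, whatever the exponent \<open>x\<close>
  (\<open>set_integrable_damped_Gamma_kernel\<close>), and the mean value inequality in \<open>\<rho>\<close> bounds the
  difference quotients by one of these kernels (\<open>has_field_derivative_Gamma_rho\<close>).  Termwise
  differentiation of the series needs only a summable majorant of the terms themselves that is locally
  uniform in \<open>\<rho>\<close>, because locally uniform limits of holomorphic functions may be differentiated
  termwise.  For large \<open>k\<close> the bound \<open>\<bar>\<Gamma>\<^sub>\<rho>(x)\<bar> \<le> \<Gamma>(Re x)\<close> provides a majorant that does not involve
  \<open>\<rho>\<close> at all, and the ratio test shows that it is summable (\<open>summable_bessel_majorant\<close>).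
\<close>

section \<open>The integral as a function of its damping parameter\<close>

lemma Gamma_kernel_integral:
  assumes "s > (0::real)"
  shows "set_integrable lborel {0<..} (\<lambda>t. t powr (s - 1) * exp (- t))"
    and "(LINT t:{0<..}|lborel. t powr (s - 1) * exp (- t)) = Gamma s"
proof -
  let ?f = "\<lambda>t::real. indicator {0..} t * t powr (s - 1) / exp t"
  have eq: "?f = (\<lambda>t. indicator {0<..} t *\<^sub>R (t powr (s - 1) * exp (- t)))"
    by (auto simp: indicator_def exp_minus field_simps fun_eq_iff)
  have "(\<integral>\<^sup>+ t. ennreal (?f t) \<partial>lborel) = ennreal (Gamma s)"
    using Gamma_conv_nn_integral_real[OF assms] by simp
  hence "integrable lborel ?f \<and> integral\<^sup>L lborel ?f = Gamma s"
    using assms by (subst (asm) nn_integral_eq_integrable) (auto simp: Gamma_real_pos less_imp_le)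
  thus "set_integrable lborel {0<..} (\<lambda>t. t powr (s - 1) * exp (- t))"
    and "(LINT t:{0<..}|lborel. t powr (s - 1) * exp (- t)) = Gamma s"
    unfolding eq set_integrable_def set_lebesgue_integral_def by auto
qed

text \<open>
  The exponent \<open>s\<close> may be any real number: \<open>exp (d / t)\<close> dominates \<open>(d / (n t)) ^ n\<close>, so the damping
  factor is worth \<open>n\<close> powers of \<open>t\<close>, and the kernel lies below a multiple of the Gamma kernel with
  exponent \<open>s + n > 0\<close>.
\<close>

lemma set_integrable_damped_Gamma_kernel:
  fixes s d :: real
  assumes "d > 0"
  shows "set_integrable lborel {0<..} (\<lambda>t. t powr (s - 1) * exp (- t - d / t))"
proof -
  obtain n :: nat where n: "real n > \<bar>s\<bar>" using reals_Archimedean2 by blast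
  hence n0: "n > 0" and sn: "s + n > 0" by auto
  let ?C = "(real n / d) ^ n"
  have bound: "t powr (s - 1) * exp (- t - d / t) \<le> ?C * (t powr (s + n - 1) * exp (- t))"
    if t: "t > 0" for t
  proof -
    have "(d / t / n) ^ n \<le> (1 + d / t / n) ^ n"
      using t assms by (intro power_mono) auto
    also have "\<dots> \<le> exp (d / t)"
      using t assms n0 by (intro exp_ge_one_plus_x_over_n_power_n) (auto intro: order_trans[of _ 0])
    finally have le: "(d / t / n) ^ n \<le> exp (d / t)" .
    have "inverse (exp (d / t)) \<le> inverse ((d / t / n) ^ n)"
      using t assms n0 by (intro le_imp_inverse_le le) auto
    also have "\<dots> = ?C * t ^ n"
      using t assms n0 by (simp add: field_simps)
    finally have "exp (- (d / t)) \<le> ?C * t powr n"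
      using t by (simp add: exp_minus powr_realpow)
    hence "t powr (s - 1) * exp (- t) * exp (- (d / t)) \<le> t powr (s - 1) * exp (- t) * (?C * t powr n)"
      by (intro mult_left_mono) auto
    moreover have "t powr (s + n - 1) = t powr (s - 1) * t powr n"
      by (simp add: powr_add [symmetric] algebra_simps)
    moreover have "exp (- t - d / t) = exp (- t) * exp (- (d / t))"
      by (simp add: exp_add [symmetric])
    ultimately show ?thesis
      by (simp add: mult_ac)
  qed
  have "set_integrable lborel {0<..} (\<lambda>t. ?C * (t powr (s + n - 1) * exp (- t)))"
    using Gamma_kernel_integral(1)[OF sn] by (intro set_integrable_mult_right) auto
  thus ?thesis
  proof (rule set_integrable_bound)
    show "set_borel_measurable lborel {0<..} (\<lambda>t. t powr (s - 1) * exp (- t - d / t))"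
      unfolding set_borel_measurable_def by measurable
    show "AE t in lborel. t \<in> {0<..} \<longrightarrow> norm (t powr (s - 1) * exp (- t - d / t))
            \<le> norm (?C * (t powr (s + n - 1) * exp (- t)))"
      using bound assms by (intro AE_I2) (auto simp: abs_mult)
  qed
qed

lemma norm_Gamma_rho_kernel:
  assumes "t > (0::real)"
  shows "norm (complex_of_real t powr (x - 1) * exp (- of_real t - \<rho> / of_real t))
           = t powr (Re x - 1) * exp (- t - Re \<rho> / t)"
  using assms by (simp add: norm_mult norm_powr_real_powr)

lemma set_integrable_Gamma_rho_kernel:
  assumes "Re \<rho> > 0"
  shows "set_integrable lborel {0<..}
           (\<lambda>t. complex_of_real t powr (x - 1) * exp (- of_real t - \<rho> / of_real t))"
    (is "set_integrable _ _ ?k")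
proof (rule set_integrable_bound[OF set_integrable_damped_Gamma_kernel[OF assms, of "Re x"]])
  have "continuous_on {0<..} ?k"
    by (intro continuous_intros continuous_on_powr_complex) (auto simp: complex_nonpos_Reals_iff)
  thus "set_borel_measurable lborel {0<..} ?k"
    unfolding set_borel_measurable_def
    using borel_measurable_continuous_on_indicator[of "{0<..}" ?k] by simp
  show "AE t in lborel. t \<in> {0<..} \<longrightarrow> norm (?k t)
          \<le> norm (t powr (Re x - 1) * exp (- t - Re \<rho> / t))"
    by (intro AE_I2) (simp add: norm_Gamma_rho_kernel del: norm_mult)
qed

lemma norm_Gamma_rho_le:
  assumes "Re \<rho> > 0" and "Re x > 0"
  shows "norm (Gamma_rho \<rho> x) \<le> Gamma (Re x)"
proof -
  let ?k = "\<lambda>t. complex_of_real t powr (x - 1) * exp (- of_real t - \<rho> / of_real t)"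
  have "norm (Gamma_rho \<rho> x) \<le> (LINT t:{0<..}|lborel. t powr (Re x - 1) * exp (- t))"
    unfolding Gamma_rho_def set_lebesgue_integral_def
  proof (rule Bochner_Integration.integral_norm_bound_integral)
    show "integrable lborel (\<lambda>t. indicator {0<..} t *\<^sub>R ?k t)"
      using set_integrable_Gamma_rho_kernel[OF assms(1)] unfolding set_integrable_def .
    show "integrable lborel (\<lambda>t. indicator {0<..} t *\<^sub>R (t powr (Re x - 1) * exp (- t)))"
      using Gamma_kernel_integral(1)[OF assms(2)] unfolding set_integrable_def .
    show "norm (indicator {0<..} t *\<^sub>R ?k t)
            \<le> indicator {0<..} t *\<^sub>R (t powr (Re x - 1) * exp (- t))" for t
      using assms by (cases "t > 0") (auto simp: norm_Gamma_rho_kernel simp del: norm_mult)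
  qed
  also have "\<dots> = Gamma (Re x)" by (rule Gamma_kernel_integral(2)[OF assms(2)])
  finally show ?thesis .
qed

text \<open>
  Differentiation under the integral sign.  On the disc of radius \<open>Re \<rho> / 2\<close> around \<open>\<rho>\<close> the
  \<open>\<rho>\<close>-derivative of the kernel is bounded by the real kernel with damping \<open>Re \<rho> / 2\<close> and exponent
  lowered by one; by the mean value inequality the same function dominates all difference quotients.
\<close>

lemma has_field_derivative_Gamma_rho:
  assumes "Re \<rho> > 0"
  shows "((\<lambda>r. Gamma_rho r x) has_field_derivative - Gamma_rho \<rho> (x - 1)) (at \<rho>)"
proof -
  define d where "d = Re \<rho> / 2"
  have d: "d > 0" using assms by (simp add: d_def)
  define k where
    "k = (\<lambda>r x t. complex_of_real t powr (x - 1) * exp (- of_real t - r / of_real t))"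
  have Re_ball: "Re y > d" if "y \<in> ball \<rho> d" for y
    using that abs_Re_le_cmod[of "\<rho> - y"] by (auto simp: dist_norm d_def)
  have deriv: "((\<lambda>r. k r x t) has_field_derivative - k y (x - 1) t) (at y within S)"
    if "t > 0" for y t S
  proof -
    have "complex_of_real t powr (x - 1) = complex_of_real t powr (x - 1 - 1) * of_real t"
      using that powr_add[of "complex_of_real t" "x - 1 - 1" 1] by simp
    thus ?thesis
      using that unfolding k_def by (auto intro!: derivative_eq_intros)
  qed
  define w where "w = (\<lambda>t. t powr (Re (x - 1) - 1) * exp (- t - d / t))"
  have quotient_le: "norm ((k y x t - k \<rho> x t) / (y - \<rho>)) \<le> w t"
    if t: "t > 0" and y: "y \<in> ball \<rho> d" "y \<noteq> \<rho>" for y t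
  proof -
    have "norm (k y x t - k \<rho> x t) \<le> w t * norm (y - \<rho>)"
    proof (rule field_differentiable_bound[of "ball \<rho> d" "\<lambda>r. k r x t" "\<lambda>r. - k r (x - 1) t"])
      fix u assume u: "u \<in> ball \<rho> d"
      show "((\<lambda>r. k r x t) has_field_derivative - k u (x - 1) t) (at u within ball \<rho> d)"
        by (rule deriv[OF t])
      have "norm (k u (x - 1) t) = t powr (Re (x - 1) - 1) * exp (- t - Re u / t)"
        unfolding k_def by (rule norm_Gamma_rho_kernel[OF t])
      also have "\<dots> \<le> w t"
        unfolding w_def using t Re_ball[OF u] by (intro mult_left_mono) (auto simp: divide_right_mono)
      finally show "norm (- k u (x - 1) t) \<le> w t" by simp
    qed (use y d in auto)
    thus ?thesis using y by (simp add: norm_divide divide_le_eq)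
  qed
  have int_k: "set_integrable lborel {0<..} (k r y)" if "Re r > 0" for r y
    using set_integrable_Gamma_rho_kernel[OF that] by (simp add: k_def)
  have Gamma_rho_k: "Gamma_rho r y = (LINT t:{0<..}|lborel. k r y t)" for r y
    by (simp add: Gamma_rho_def k_def)
  have "((\<lambda>y. (Gamma_rho y x - Gamma_rho \<rho> x) / (y - \<rho>)) \<longlongrightarrow> - Gamma_rho \<rho> (x - 1))
          (at \<rho> within ball \<rho> d)"
    unfolding tendsto_at_iff_sequentially comp_def
  proof (intro allI impI)
    fix Y assume Y: "\<forall>i. Y i \<in> ball \<rho> d - {\<rho>}" and lim: "Y \<longlonglongrightarrow> \<rho>"
    let ?q = "\<lambda>i t. indicator {0<..} t *\<^sub>R ((k (Y i) x t - k \<rho> x t) / (Y i - \<rho>))"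
    have pos: "Re (Y i) > 0" for i using Y Re_ball[of "Y i"] d by fastforce
    have int_q: "set_integrable lborel {0<..} (\<lambda>t. (k (Y i) x t - k \<rho> x t) / (Y i - \<rho>))" for i
      using int_k[OF pos[of i], of x] int_k[OF assms, of x] by auto
    have "(\<lambda>i. integral\<^sup>L lborel (?q i)) \<longlonglongrightarrow>
            integral\<^sup>L lborel (\<lambda>t. indicator {0<..} t *\<^sub>R (- k \<rho> (x - 1) t))"
    proof (rule integral_dominated_convergence)
      show "(\<lambda>t. indicator {0<..} t *\<^sub>R (- k \<rho> (x - 1) t)) \<in> borel_measurable lborel"
        using int_k[OF assms, of "x - 1"] unfolding set_integrable_def by auto
      show "?q i \<in> borel_measurable lborel" for i
        using int_q[of i] unfolding set_integrable_def by auto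
      show "integrable lborel (\<lambda>t. indicator {0<..} t *\<^sub>R w t)"
        using set_integrable_damped_Gamma_kernel[OF d] unfolding set_integrable_def w_def .
      show "AE t in lborel. norm (?q i t) \<le> indicator {0<..} t *\<^sub>R w t" for i
        using quotient_le Y by (intro AE_I2) (auto simp: indicator_def)
      show "AE t in lborel. (\<lambda>i. ?q i t) \<longlonglongrightarrow> indicator {0<..} t *\<^sub>R (- k \<rho> (x - 1) t)"
      proof (rule AE_I2)
        fix t :: real
        show "(\<lambda>i. ?q i t) \<longlonglongrightarrow> indicator {0<..} t *\<^sub>R (- k \<rho> (x - 1) t)"
        proof (cases "t > 0")
          case True
          have "((\<lambda>y. (k y x t - k \<rho> x t) / (y - \<rho>)) \<longlongrightarrow> - k \<rho> (x - 1) t) (at \<rho>)"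
            using deriv[OF True, of \<rho> UNIV] by (simp add: has_field_derivative_iff)
          moreover have "filterlim Y (at \<rho>) sequentially"
            using lim Y by (auto simp: filterlim_at)
          ultimately show ?thesis
            using True by (auto dest: filterlim_compose)
        qed simp
      qed
    qed
    moreover have "integral\<^sup>L lborel (?q i) = (Gamma_rho (Y i) x - Gamma_rho \<rho> x) / (Y i - \<rho>)" for i
      using set_integral_diff(2)[OF int_k[OF pos[of i], of x] int_k[OF assms, of x]]
        set_integral_divide_zero[of lborel "{0<..}" "\<lambda>t. k (Y i) x t - k \<rho> x t" "Y i - \<rho>"]
      unfolding Gamma_rho_k set_lebesgue_integral_def by simp
    moreover have "integral\<^sup>L lborel (\<lambda>t. indicator {0<..} t *\<^sub>R (- k \<rho> (x - 1) t))
                     = - Gamma_rho \<rho> (x - 1)"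
      by (simp add: Gamma_rho_k set_lebesgue_integral_def)
    ultimately show "(\<lambda>i. (Gamma_rho (Y i) x - Gamma_rho \<rho> x) / (Y i - \<rho>)) \<longlonglongrightarrow> - Gamma_rho \<rho> (x - 1)"
      by simp
  qed
  thus ?thesis
    using d by (simp add: has_field_derivative_iff at_within_open[of \<rho> "ball \<rho> d"])
qed

lemma has_field_derivative_gen_pochhammer:
  assumes "Re \<rho> > 0" and "l \<noteq> 1"
  shows "((\<lambda>r. gen_pochhammer l r \<nu>) has_field_derivative
            (- 1 / (l - 1)) * gen_pochhammer (l - 1) \<rho> \<nu>) (at \<rho>)"
proof -
  have "rGamma (l - 1) = (l - 1) * rGamma l"
    using rGamma_plus1[of "l - 1"] by simp
  hence "(- 1 / (l - 1)) * gen_pochhammer (l - 1) \<rho> \<nu> = - Gamma_rho \<rho> (l + \<nu> - 1) * rGamma l"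
    using assms(2) by (simp add: gen_pochhammer_def diff_add_eq)
  thus ?thesis
    using DERIV_cmult_right[OF has_field_derivative_Gamma_rho[OF assms(1), of "l + \<nu>"], of "rGamma l"]
    unfolding gen_pochhammer_def by simp
qed

section \<open>Termwise differentiation of the series\<close>

text \<open>
  The coefficients lose a factor of order \<open>k ^ 4\<close> at each step, while \<open>\<Gamma>(s + 2 k)\<close> gains only a factor
  of order \<open>k ^ 2\<close>; so the quotient of successive terms tends to \<open>0\<close>.
\<close>

lemma summable_bessel_majorant:
  fixes \<nu> q :: complex and s :: real
  shows "summable (\<lambda>k. norm (q ^ k * rGamma (\<nu> + of_nat k + 1) * rGamma (\<nu> + 2 * of_nat k + 1)
                            / fact k) * Gamma (s + 2 * real k))"
proof -
  define a where
    "a = (\<lambda>k. q ^ k * rGamma (\<nu> + of_nat k + 1) * rGamma (\<nu> + 2 * of_nat k + 1) / fact k)"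
  define G where "G = (\<lambda>k. Gamma (s + 2 * real k))"
  \<comment> \<open>From index \<open>N\<close> on, \<open>s + 2 k\<close> lies between \<open>0\<close> and \<open>3 k\<close>, the linear factors \<open>\<nu> + m\<close> with \<open>m > k\<close>
    have norm at least \<open>m - k\<close>, and the resulting bound \<open>12 \<bar>q\<bar> / (k + 1)\<close> on the quotient of
    successive terms is at most \<open>1 / 2\<close>.\<close>
  obtain N :: nat where "real N > max (\<bar>s\<bar> + 1) (max (norm \<nu>) (24 * norm q))"
    using reals_Archimedean2 by blast
  hence N: "real N > \<bar>s\<bar> + 1" "real N > norm \<nu>" "real N > 24 * norm q" by auto
  have "summable (\<lambda>k. norm (a k) * G k)"
  proof (rule summable_ratio_test)
    show "1 / 2 < (1::real)" by simp
    fix k assume "k \<ge> N"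
    hence kN: "real k \<ge> real N" by simp
    have k: "real k > \<bar>s\<bar> + 1" "real k > norm \<nu>" "real k > 24 * norm q" "real k > 0"
      using kN N by linarith+
    let ?x = "\<nu> + of_nat k + 1" and ?y = "\<nu> + 2 * of_nat k + 1"
    have rearrange: "q ^ Suc k * A * B / (n * F) * (x * y * w * n)
                       = q * (q ^ k * (x * A) * (y * w * B) / F)"
      if "n \<noteq> 0" for A B F n x y w :: complex
      using that by (simp add: field_simps)
    have "rGamma ?x = ?x * rGamma (\<nu> + of_nat (Suc k) + 1)"
      using rGamma_plus1[of ?x] by (simp add: algebra_simps)
    moreover have "rGamma ?y = ?y * (?y + 1) * rGamma (\<nu> + 2 * of_nat (Suc k) + 1)"
    proof -
      have "?y + 1 + 1 = \<nu> + 2 * of_nat (Suc k) + 1" by simp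
      hence "(?y + 1) * rGamma (\<nu> + 2 * of_nat (Suc k) + 1) = rGamma (?y + 1)"
        using rGamma_plus1[of "?y + 1"] by (simp only:)
      thus ?thesis
        using rGamma_plus1[of ?y] by (simp only: mult.assoc)
    qed
    moreover have "fact (Suc k) = of_nat (Suc k) * (fact k :: complex)"
      by (rule fact_Suc)
    ultimately have "a (Suc k) * (?x * ?y * (?y + 1) * of_nat (Suc k)) = q * a k"
      by (simp only: a_def rearrange[OF of_nat_neq_0])
    hence "norm (a (Suc k) * (?x * ?y * (?y + 1) * of_nat (Suc k))) = norm (q * a k)"
      by (rule arg_cong)
    hence a: "norm (a (Suc k)) * (norm ?x * norm ?y * norm (?y + 1) * real (Suc k))
                = norm q * norm (a k)"
      by (simp only: norm_mult norm_of_nat)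
    have shift: "norm (\<nu> + of_nat m) \<ge> real m - norm \<nu>" for m
      using norm_diff_ineq[of "of_nat m" \<nu>] by (simp add: add.commute)
    have "norm ?x \<ge> 1"
      using shift[of "Suc k"] k by (simp add: add_ac)
    moreover have "norm ?y \<ge> k"
      using shift[of "Suc (2 * k)"] k by (simp add: add_ac)
    moreover have "norm (?y + 1) \<ge> k"
      using shift[of "2 * k + 2"] k by (simp add: add_ac)
    ultimately have P: "1 * real k * real k * real (Suc k) \<le> norm ?x * norm ?y * norm (?y + 1) * Suc k"
      by (intro mult_mono) auto
    have "G (Suc k) = (s + 2 * k + 1) * ((s + 2 * k) * G k)"
    proof -
      have "s + 2 * k \<notin> \<int>\<^sub>\<le>\<^sub>0" "s + 2 * k + 1 \<notin> \<int>\<^sub>\<le>\<^sub>0"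
        using k by (auto elim!: nonpos_Ints_cases)
      thus ?thesis
        using Gamma_plus1[of "s + 2 * k"] Gamma_plus1[of "s + 2 * k + 1"]
        by (simp add: G_def algebra_simps)
    qed
    moreover have pos: "G k > 0" unfolding G_def using k by (intro Gamma_real_pos) auto
    moreover have "(s + 2 * k + 1) * (s + 2 * k) \<le> (4 * k) * (3 * real k)"
      using k by (intro mult_mono) auto
    ultimately have G: "G (Suc k) \<le> 12 * (k * k) * G k" "G (Suc k) > 0"
      using k by (auto simp: mult.assoc [symmetric] intro!: mult_right_mono mult_pos_pos)
    let ?n = "norm (a (Suc k))"
    have "?n * (1 * real k * real k * real (Suc k)) \<le> norm q * norm (a k)"
      unfolding a [symmetric] by (rule mult_left_mono[OF P]) simp
    hence "(?n * (real k * k * real (Suc k))) * G (Suc k) \<le> (norm q * norm (a k)) * G (Suc k)"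
      using G(2) by (intro mult_right_mono) (simp_all del: of_nat_Suc)
    also have "\<dots> \<le> (norm q * norm (a k)) * (12 * (k * k) * G k)"
      by (intro mult_left_mono G) auto
    finally have "(k * k) * (?n * G (Suc k) * Suc k) \<le> (k * k) * (12 * norm q * (norm (a k) * G k))"
      by (simp add: mult_ac del: of_nat_Suc)
    hence "?n * G (Suc k) * Suc k \<le> 12 * norm q * (norm (a k) * G k)"
      using k(4) by (subst (asm) mult_le_cancel_left_pos) auto
    also have "\<dots> \<le> (1 / 2 * Suc k) * (norm (a k) * G k)"
      using k pos by (intro mult_right_mono) auto
    finally have "(?n * G (Suc k)) * Suc k \<le> (1 / 2 * (norm (a k) * G k)) * Suc k"
      by (simp add: mult_ac del: of_nat_Suc)
    hence "?n * G (Suc k) \<le> 1 / 2 * (norm (a k) * G k)"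
      by (subst (asm) mult_le_cancel_right_pos) auto
    thus "norm (?n * G (Suc k)) \<le> 1 / 2 * norm (norm (a k) * G k)"
      using G(2) pos by (simp add: abs_mult)
  qed
  thus ?thesis by (simp only: a_def G_def)
qed

text \<open>
  On the right half-plane the terms of the series are eventually bounded by a summable sequence
  independent of \<open>\<rho>\<close>.  The terms are holomorphic there, so the derivative of the sum is the sum of the
  derivatives, with no separate estimate of the latter; their convergence is part of the conclusion.
\<close>

theorem has_field_derivative_bessel_G:
  assumes \<rho>: "Re \<rho> > 0" and z: "z \<noteq> 0" and l: "l \<noteq> 1"
  shows "((\<lambda>r. bessel_G \<nu> b l z r) has_field_derivative
            (- 1 / (l - 1)) * bessel_G \<nu> b (l - 1) z \<rho>) (at \<rho>)"
proof -
  define T where "T = (\<lambda>l k r. (- b) ^ k * gen_pochhammer l r (2 * of_nat k + \<nu>)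
           * rGamma (\<nu> + of_nat k + 1) * rGamma (\<nu> + 2 * of_nat k + 1)
           * ((z / 2) powr (2 * of_nat k + \<nu>) / fact k))"
  define q where "q = - b * (z / 2)\<^sup>2"
  define s where "s = Re (l + \<nu>)"
  define B where "B = (\<lambda>k. norm (q ^ k * rGamma (\<nu> + of_nat k + 1) * rGamma (\<nu> + 2 * of_nat k + 1)
                            / fact k) * Gamma (s + 2 * real k))"
  define K where "K = norm (rGamma l) * norm ((z / 2) powr \<nu>)"
  define S where "S = {r :: complex. Re r > 0}"
  have summable_majorant: "summable (\<lambda>k. K * \<bar>B k\<bar>)"
  proof -
    obtain N :: nat where N: "real N > \<bar>s\<bar>" using reals_Archimedean2 by blast
    \<comment> \<open>Only finitely many \<open>B k\<close> can be negative, namely those with \<open>s + 2 k < 0\<close>; passing to absolute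
      values therefore preserves summability.\<close>
    have "\<forall>\<^sub>F k in sequentially. \<bar>B k\<bar> = B k"
      using eventually_ge_at_top[of N]
    proof eventually_elim
      case (elim k)
      hence "Gamma (s + 2 * real k) > 0" using N by (intro Gamma_real_pos) linarith
      thus ?case unfolding B_def by (simp add: abs_mult)
    qed
    hence "summable (\<lambda>k. \<bar>B k\<bar>)"
      using summable_bessel_majorant[of q \<nu> s] unfolding B_def by (subst summable_cong) auto
    thus ?thesis by (rule summable_mult)
  qed
  have T_le: "norm (T l k r) \<le> K * \<bar>B k\<bar>" if "r \<in> S" and k: "real k > \<bar>s\<bar>" for k r
  proof -
    have "(z / 2) powr (2 * of_nat k + \<nu>) = (z / 2) powr \<nu> * ((z / 2)\<^sup>2) ^ k"
    proof -
      have "(z / 2) powr (2 * of_nat k) = (z / 2) ^ (2 * k)"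
        using z powr_nat'[of "z / 2" "2 * k"] by simp
      thus ?thesis by (simp only: powr_add power_mult mult.commute[of "(z / 2) powr \<nu>"])
    qed
    hence T_eq: "T l k r = (rGamma l * (z / 2) powr \<nu>) * (q ^ k * rGamma (\<nu> + of_nat k + 1)
                    * rGamma (\<nu> + 2 * of_nat k + 1) / fact k) * Gamma_rho r (l + (2 * of_nat k + \<nu>))"
      unfolding T_def gen_pochhammer_def q_def by (simp only: power_mult_distrib) (simp add: mult_ac)
    have Re_eq: "Re (l + (2 * of_nat k + \<nu>)) = s + 2 * real k" by (simp add: s_def)
    have "norm (Gamma_rho r (l + (2 * of_nat k + \<nu>))) \<le> Gamma (s + 2 * real k)"
      using norm_Gamma_rho_le[of r "l + (2 * of_nat k + \<nu>)"] that unfolding Re_eq S_def by auto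
    hence "norm (Gamma_rho r (l + (2 * of_nat k + \<nu>))) \<le> \<bar>Gamma (s + 2 * real k)\<bar>" by linarith
    hence "norm (T l k r) \<le> (K * norm (q ^ k * rGamma (\<nu> + of_nat k + 1)
              * rGamma (\<nu> + 2 * of_nat k + 1) / fact k)) * \<bar>Gamma (s + 2 * real k)\<bar>"
      unfolding T_eq norm_mult K_def by (intro mult_left_mono mult_nonneg_nonneg norm_ge_zero)
    thus ?thesis unfolding B_def by (simp add: abs_mult mult.assoc)
  qed
  have "\<exists>g g'. \<forall>r\<in>S. ((\<lambda>k. T l k r) sums g r) \<and>
           ((\<lambda>k. (- 1 / (l - 1)) * T (l - 1) k r) sums g' r) \<and> (g has_field_derivative g' r) (at r)"
  proof (rule series_and_derivative_comparison_complex)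
    show "open S" unfolding S_def by (rule open_halfspace_Re_gt)
    show "((\<lambda>r. T l k r) has_field_derivative (- 1 / (l - 1)) * T (l - 1) k r) (at r)"
      if "r \<in> S" for k r
      using that l has_field_derivative_gen_pochhammer[of r l "2 * of_nat k + \<nu>"]
      unfolding T_def S_def by (auto intro!: derivative_eq_intros)
    obtain N :: nat where N: "real N > \<bar>s\<bar>" using reals_Archimedean2 by blast
    have "\<forall>\<^sub>F k in sequentially. \<forall>y\<in>ball r 1 \<inter> S.
            norm (T l k y) \<le> norm (complex_of_real (K * \<bar>B k\<bar>))" for r
      using eventually_ge_at_top[of N]
    proof eventually_elim
      case (elim k)
      hence "real k > \<bar>s\<bar>" using N by linarith
      thus ?case using T_le[of _ k] by (force simp: abs_mult norm_mult K_def)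
    qed
    moreover have "summable (\<lambda>k. complex_of_real (K * \<bar>B k\<bar>))"
      using summable_majorant by (rule summable_of_real)
    moreover have "range (\<lambda>k. complex_of_real (K * \<bar>B k\<bar>)) \<subseteq> \<real>\<^sub>\<ge>\<^sub>0"
      by (auto simp: K_def)
    ultimately show "\<exists>d h. 0 < d \<and> summable h \<and> range h \<subseteq> \<real>\<^sub>\<ge>\<^sub>0 \<and>
          (\<forall>\<^sub>F k in sequentially. \<forall>y\<in>ball r d \<inter> S. norm (T l k y) \<le> cmod (h k))" for r
      by (intro exI[of _ 1] exI[of _ "\<lambda>k. complex_of_real (K * \<bar>B k\<bar>)"] conjI zero_less_one)
  qed
  then obtain g g' where g: "\<And>r. r \<in> S \<Longrightarrow> (\<lambda>k. T l k r) sums g r"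
    and g': "\<And>r. r \<in> S \<Longrightarrow> (\<lambda>k. (- 1 / (l - 1)) * T (l - 1) k r) sums g' r"
    and deriv: "\<And>r. r \<in> S \<Longrightarrow> (g has_field_derivative g' r) (at r)"
    by blast
  have "\<rho> \<in> S" using \<rho> by (simp add: S_def)
  have "(\<lambda>k. T (l - 1) k \<rho>) sums (g' \<rho> / (- 1 / (l - 1)))"
    using sums_divide[OF g'[OF \<open>\<rho> \<in> S\<close>], of "- 1 / (l - 1)"] l by simp
  hence "bessel_G \<nu> b (l - 1) z \<rho> = g' \<rho> / (- 1 / (l - 1))"
    unfolding bessel_G_def T_def by (simp add: sums_iff)
  hence "g' \<rho> = (- 1 / (l - 1)) * bessel_G \<nu> b (l - 1) z \<rho>"
    using l by simp
  hence "(g has_field_derivative (- 1 / (l - 1)) * bessel_G \<nu> b (l - 1) z \<rho>) (at \<rho>)"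
    using deriv[OF \<open>\<rho> \<in> S\<close>] by simp
  moreover have "g r = bessel_G \<nu> b l z r" if "r \<in> S" for r
    using g[OF that] unfolding bessel_G_def T_def by (simp add: sums_iff)
  moreover have "open S" unfolding S_def by (rule open_halfspace_Re_gt)
  ultimately show ?thesis
    using \<open>\<rho> \<in> S\<close> by (metis (no_types, lifting) has_field_derivative_transform_within_open)
qed

section \<open>Spherical Bessel and Bessel-Clifford functions\<close>

theorem theorem6p10:
  fixes b \<rho> z :: complex
  assumes "Re \<rho> > 0" and "z \<notin> \<real>\<^sub>\<le>\<^sub>0"
  shows "(\<forall>\<nu> c :: complex. Re \<nu> > - 3/2 \<longrightarrow> Re c > 1/2 \<longrightarrow> c \<noteq> 3/2 \<longrightarrow>
            ((\<lambda>r. spherical_bessel_g \<nu> b c z r) has_field_derivative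
               (- 1 / (c - 3/2)) * spherical_bessel_g \<nu> b (c - 1) z \<rho>) (at \<rho>))
       \<and> (\<forall>\<nu> l :: complex. Re \<nu> > - 1 \<longrightarrow> Re l > 0 \<longrightarrow> l \<noteq> 1 \<longrightarrow>
            ((\<lambda>r. bessel_clifford_C \<nu> b l z r) has_field_derivative
               (- 1 / (l - 1)) * bessel_clifford_C \<nu> b (l - 1) z \<rho>) (at \<rho>))"
proof (intro conjI allI impI)
  have z: "z \<noteq> 0" using assms(2) by auto
  fix \<nu> c :: complex assume "c \<noteq> 3/2"
  hence "c - 1/2 \<noteq> 1" by (auto simp: field_simps)
  moreover have "c - 1/2 - 1 = c - 3/2" "c - 1 - 1/2 = c - 3/2" by simp_all
  ultimately show "((\<lambda>r. spherical_bessel_g \<nu> b c z r) has_field_derivative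
               (- 1 / (c - 3/2)) * spherical_bessel_g \<nu> b (c - 1) z \<rho>) (at \<rho>)"
    using DERIV_cmult[OF has_field_derivative_bessel_G[OF assms(1) z, of "c - 1/2" "\<nu> + 1/2" b]]
    unfolding spherical_bessel_g_def by (simp add: mult_ac)
next
  have z: "2 * csqrt z \<noteq> 0" using assms(2) by auto
  fix \<nu> l :: complex assume "l \<noteq> 1"
  thus "((\<lambda>r. bessel_clifford_C \<nu> b l z r) has_field_derivative
               (- 1 / (l - 1)) * bessel_clifford_C \<nu> b (l - 1) z \<rho>) (at \<rho>)"
    using DERIV_cmult[OF has_field_derivative_bessel_G[OF assms(1) z, of l \<nu> b]]
    unfolding bessel_clifford_C_def by (simp add: mult_ac)
qed

end
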